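(* Let $\mathbf{C}$ and $\mathbf{D}$ be categories such that $\mathbf{C}$ has the canonical Ramsey property. If there exists a canonical pre-adjunction $F:\mathrm{Ob}(\mathbf{D})\rightleftarrows\mathrm{Ob}(\mathbf{C}):G$ between $\mathbf{C}$ and $\mathbf{D}$, then $\mathbf{D}$ has the canonical Ramsey property.
   Context: A pair of maps $F:\mathrm{Ob}(\mathbf{D})\to\mathrm{Ob}(\mathbf{C})$, $G:\mathrm{Ob}(\mathbf{C})\to\mathrm{Ob}(\mathbf{D})$ is a canonical pre-adjunction between $\mathbf{C}$ and $\mathbf{D}$ if there are families of maps $\Phi_{Y,X}:\hom_{\mathbf{C}}(F(Y),X)\to\hom_{\mathbf{D}}(Y,G(X))$ and $F_{Y,X}:\hom_{\mathbf{D}}(Y,X)\to\hom_{\mathbf{C}}(F(Y),F(X))$ (written simply $F(f)$) such that: (CPA1) for all $C\in\mathrm{Ob}(\mathbf{C})$, $D,E\in\mathrm{Ob}(\mathbf{D})$, $u\in\hom_{\mathbf{C}}(F(D),C)$ and $f\in\hom_{\mathbf{D}}(E,D)$: $\Phi_{D,C}(u)\cdot f=\Phi_{E,C}(u\cdot F(f))$; (CPA2) for all $D,E\in\mathrm{Ob}(\mathbf{D})$, $Q\in\mathrm{Ob}(\mathbf{C})$ and $q\in\hom_{\mathbf{C}}(Q,F(E))$ there exist $Q'\in\mathrm{Ob}(\mathbf{D})$ and $q'\in\hom_{\mathbf{D}}(Q',E)$ such that for all $f,g\in\hom_{\mathbf{D}}(E,D)$: $F(f)\cdot q=F(g)\cdot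 q$ iff $f\cdot q'=g\cdot q'$. ($F,G$ need not be functors.) For objects $A,B,C$ of a category, $C\xrightarrow{can}(B)^A$ means: for every $\chi:\hom(A,C)\to\omega$ there exist $w\in\hom(B,C)$, an object $Q$ and $q\in\hom(Q,A)$ such that for all $f,g\in\hom(A,B)$, $\chi(w\cdot f)=\chi(w\cdot g)$ iff $f\cdot q=g\cdot q$. A category has the canonical Ramsey property if for all objects $A,B$ with $\hom(A,B)\neq\varnothing$ there is an object $C$ with $C\xrightarrow{can}(B)^A$. *)

theory Defs
  imports Main "HOL-Library.FuncSet"
begin

record ('o, 'm) category =
  Ob :: "'o set"
  Arr :: "'m set"
  Dom :: "'m \<Rightarrow> 'o"
  Cod :: "'m \<Rightarrow> 'o"
  Id :: "'o \<Rightarrow> 'm"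
  Comp :: "'m \<Rightarrow> 'm \<Rightarrow> 'm"  (infixl "\<cdot>\<index>" 70)

definition hom :: "('o, 'm, 'z) category_scheme \<Rightarrow> 'o \<Rightarrow> 'o \<Rightarrow> 'm set" where
  "hom C A B = {f \<in> Arr C. Dom C f = A \<and> Cod C f = B}"

text \<open>Composition is written in applicative order: \<open>g \<cdot> f\<close> means first \<open>f\<close>, then \<open>g\<close>.\<close>

locale category =
  fixes C :: "('o, 'm, 'z) category_scheme" (structure)
  assumes Dom_closed: "f \<in> Arr C \<Longrightarrow> Dom C f \<in> Ob C"
    and Cod_closed: "f \<in> Arr C \<Longrightarrow> Cod C f \<in> Ob C"
    and Id_closed: "A \<in> Ob C \<Longrightarrow> Id C A \<in> hom C A A"
    and Comp_closed: "f \<in> hom C X Y \<Longrightarrow> g \<in> hom C Y Z \<Longrightarrow> g \<cdot> f \<in> hom C X Z"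
    and Comp_assoc: "f \<in> hom C W X \<Longrightarrow> g \<in> hom C X Y \<Longrightarrow> h \<in> hom C Y Z
      \<Longrightarrow> (h \<cdot> g) \<cdot> f = h \<cdot> (g \<cdot> f)"
    and Id_left: "f \<in> hom C X Y \<Longrightarrow> Id C Y \<cdot> f = f"
    and Id_right: "f \<in> hom C X Y \<Longrightarrow> f \<cdot> Id C X = f"

text \<open>\<open>can_arrow C Z B A\<close> is the canonical partition relation \<open>Z \<rightarrow> (B)\<^sup>A\<close> in the category \<open>C\<close>.
  Values of the colouring \<open>\<chi>\<close> outside \<open>hom C A Z\<close> are irrelevant.\<close>

definition can_arrow :: "('o, 'm, 'z) category_scheme \<Rightarrow> 'o \<Rightarrow> 'o \<Rightarrow> 'o \<Rightarrow> bool" where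
  "can_arrow C Z B A \<longleftrightarrow>
    (\<forall>\<chi> :: 'm \<Rightarrow> nat. \<exists>w \<in> hom C B Z. \<exists>Q \<in> Ob C. \<exists>q \<in> hom C Q A.
      \<forall>f \<in> hom C A B. \<forall>g \<in> hom C A B.
        \<chi> (w \<cdot>\<^bsub>C\<^esub> f) = \<chi> (w \<cdot>\<^bsub>C\<^esub> g) \<longleftrightarrow> f \<cdot>\<^bsub>C\<^esub> q = g \<cdot>\<^bsub>C\<^esub> q)"

definition canonical_ramsey_property :: "('o, 'm, 'z) category_scheme \<Rightarrow> bool" where
  "canonical_ramsey_property C \<longleftrightarrow>
    (\<forall>A \<in> Ob C. \<forall>B \<in> Ob C. hom C A B \<noteq> {} \<longrightarrow> (\<exists>Z \<in> Ob C. can_arrow C Z B A))"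

text \<open>\<open>F\<close>, \<open>G\<close> are the object maps; \<open>\<Phi> Y X\<close> and \<open>Fm Y X\<close> are the two families of maps between
  hom-sets. Neither \<open>F\<close> nor \<open>G\<close> is required to be functorial.\<close>

definition canonical_pre_adjunction ::
  "('oc, 'mc, 'yc) category_scheme \<Rightarrow> ('od, 'md, 'yd) category_scheme
    \<Rightarrow> ('od \<Rightarrow> 'oc) \<Rightarrow> ('oc \<Rightarrow> 'od) \<Rightarrow> bool" where
  "canonical_pre_adjunction C D F G \<longleftrightarrow>
    F \<in> Ob D \<rightarrow> Ob C \<and> G \<in> Ob C \<rightarrow> Ob D \<and>
    (\<exists>(\<Phi> :: 'od \<Rightarrow> 'oc \<Rightarrow> 'mc \<Rightarrow> 'md) (Fm :: 'od \<Rightarrow> 'od \<Rightarrow> 'md \<Rightarrow> 'mc).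
      (\<forall>Y \<in> Ob D. \<forall>X \<in> Ob C. \<Phi> Y X \<in> hom C (F Y) X \<rightarrow> hom D Y (G X)) \<and>
      (\<forall>Y \<in> Ob D. \<forall>X \<in> Ob D. Fm Y X \<in> hom D Y X \<rightarrow> hom C (F Y) (F X)) \<and>
      (\<forall>X \<in> Ob C. \<forall>Y \<in> Ob D. \<forall>E \<in> Ob D. \<forall>u \<in> hom C (F Y) X. \<forall>f \<in> hom D E Y.
        \<Phi> Y X u \<cdot>\<^bsub>D\<^esub> f = \<Phi> E X (u \<cdot>\<^bsub>C\<^esub> Fm E Y f)) \<and>
      (\<forall>Y \<in> Ob D. \<forall>E \<in> Ob D. \<forall>Q \<in> Ob C. \<forall>q \<in> hom C Q (F E).
        \<exists>Q' \<in> Ob D. \<exists>q' \<in> hom D Q' E. \<forall>f \<in> hom D E Y. \<forall>g \<in> hom D E Y.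
          Fm E Y f \<cdot>\<^bsub>C\<^esub> q = Fm E Y g \<cdot>\<^bsub>C\<^esub> q \<longleftrightarrow> f \<cdot>\<^bsub>D\<^esub> q' = g \<cdot>\<^bsub>D\<^esub> q'))"

end

theory Submission
  imports Defs
begin

text \<open>A colouring \<open>\<chi>\<close> of \<open>hom D A (G Z)\<close> pulls back along \<open>\<Phi> A Z\<close> to a colouring of
  \<open>hom C (F A) Z\<close>. If the latter is canonical on \<open>w\<close> via \<open>q\<close>, then by (CPA1) \<open>\<chi>\<close> is
  canonical on \<open>\<Phi> B Z w\<close> via the \<open>q'\<close> that (CPA2) provides for \<open>q\<close>.\<close>

definition canonical_via ::
  "('o, 'm, 'z) category_scheme \<Rightarrow> 'o \<Rightarrow> 'o \<Rightarrow> ('m \<Rightarrow> 'k) \<Rightarrow> 'm \<Rightarrow> bool" where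
  "canonical_via C A B \<kappa> q \<longleftrightarrow>
    (\<forall>f \<in> hom C A B. \<forall>g \<in> hom C A B. \<kappa> f = \<kappa> g \<longleftrightarrow> f \<cdot>\<^bsub>C\<^esub> q = g \<cdot>\<^bsub>C\<^esub> q)"

lemma canonical_via_pullback:
  assumes h: "h \<in> hom D A B \<rightarrow> hom C A' B'"
    and \<kappa>: "canonical_via C A' B' \<kappa> q"
    and q': "canonical_via D A B (\<lambda>f. h f \<cdot>\<^bsub>C\<^esub> q) q'"
  shows "canonical_via D A B (\<lambda>f. \<kappa> (h f)) q'"
  unfolding canonical_via_def
proof (intro ballI)
  fix f g
  assume f: "f \<in> hom D A B" and g: "g \<in> hom D A B"
  have "\<kappa> (h f) = \<kappa> (h g) \<longleftrightarrow> h f \<cdot>\<^bsub>C\<^esub> q = h g \<cdot>\<^bsub>C\<^esub> q"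
    using \<kappa> funcset_mem[OF h f] funcset_mem[OF h g] by (simp add: canonical_via_def)
  also have "\<dots> \<longleftrightarrow> f \<cdot>\<^bsub>D\<^esub> q' = g \<cdot>\<^bsub>D\<^esub> q'"
    using q' f g by (simp add: canonical_via_def)
  finally show "\<kappa> (h f) = \<kappa> (h g) \<longleftrightarrow> f \<cdot>\<^bsub>D\<^esub> q' = g \<cdot>\<^bsub>D\<^esub> q'" .
qed

lemma can_arrow_iff_canonical_via:
  fixes C :: "('o, 'm, 'z) category_scheme"
  shows "can_arrow C Z B A \<longleftrightarrow>
    (\<forall>\<chi> :: 'm \<Rightarrow> nat. \<exists>w \<in> hom C B Z. \<exists>Q \<in> Ob C. \<exists>q \<in> hom C Q A.
      canonical_via C A B (\<lambda>f. \<chi> (w \<cdot>\<^bsub>C\<^esub> f)) q)"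
  by (simp add: can_arrow_def canonical_via_def)

locale canonical_pre_adjunction_maps =
  fixes C :: "('oc, 'mc, 'yc) category_scheme" and D :: "('od, 'md, 'yd) category_scheme"
    and F :: "'od \<Rightarrow> 'oc" and G :: "'oc \<Rightarrow> 'od"
    and \<Phi> :: "'od \<Rightarrow> 'oc \<Rightarrow> 'mc \<Rightarrow> 'md" and Fm :: "'od \<Rightarrow> 'od \<Rightarrow> 'md \<Rightarrow> 'mc"
  assumes F_Ob: "Y \<in> Ob D \<Longrightarrow> F Y \<in> Ob C"
    and G_Ob: "X \<in> Ob C \<Longrightarrow> G X \<in> Ob D"
    and \<Phi>_hom: "Y \<in> Ob D \<Longrightarrow> X \<in> Ob C \<Longrightarrow> \<Phi> Y X \<in> hom C (F Y) X \<rightarrow> hom D Y (G X)"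
    and Fm_hom: "E \<in> Ob D \<Longrightarrow> Y \<in> Ob D \<Longrightarrow> Fm E Y \<in> hom D E Y \<rightarrow> hom C (F E) (F Y)"
    and \<Phi>_Comp: "X \<in> Ob C \<Longrightarrow> Y \<in> Ob D \<Longrightarrow> E \<in> Ob D \<Longrightarrow> u \<in> hom C (F Y) X \<Longrightarrow> f \<in> hom D E Y
      \<Longrightarrow> \<Phi> Y X u \<cdot>\<^bsub>D\<^esub> f = \<Phi> E X (u \<cdot>\<^bsub>C\<^esub> Fm E Y f)"
    and Fm_canonical: "Y \<in> Ob D \<Longrightarrow> E \<in> Ob D \<Longrightarrow> Q \<in> Ob C \<Longrightarrow> q \<in> hom C Q (F E)
      \<Longrightarrow> \<exists>Q' \<in> Ob D. \<exists>q' \<in> hom D Q' E. canonical_via D E Y (\<lambda>f. Fm E Y f \<cdot>\<^bsub>C\<^esub> q) q'"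
begin

lemma can_arrow_transfer:
  assumes A: "A \<in> Ob D" and B: "B \<in> Ob D" and Z: "Z \<in> Ob C"
    and arrow: "can_arrow C Z (F B) (F A)"
  shows "can_arrow D (G Z) B A"
  unfolding can_arrow_iff_canonical_via
proof
  fix \<chi> :: "'md \<Rightarrow> nat"
  obtain w Q q where w: "w \<in> hom C (F B) Z" and Q: "Q \<in> Ob C" and q: "q \<in> hom C Q (F A)"
    and pulled_back: "canonical_via C (F A) (F B) (\<lambda>u. \<chi> (\<Phi> A Z (w \<cdot>\<^bsub>C\<^esub> u))) q"
    using arrow[unfolded can_arrow_iff_canonical_via, THEN spec, of "\<lambda>u. \<chi> (\<Phi> A Z u)"] by blast
  obtain Q' q' where Q': "Q' \<in> Ob D" and q': "q' \<in> hom D Q' A"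
    and Fm_q: "canonical_via D A B (\<lambda>f. Fm A B f \<cdot>\<^bsub>C\<^esub> q) q'"
    using Fm_canonical[OF B A Q q] by blast
  have "canonical_via D A B (\<lambda>f. \<chi> (\<Phi> A Z (w \<cdot>\<^bsub>C\<^esub> Fm A B f))) q'"
    using Fm_hom[OF A B] pulled_back Fm_q by (rule canonical_via_pullback)
  then have "canonical_via D A B (\<lambda>f. \<chi> (\<Phi> B Z w \<cdot>\<^bsub>D\<^esub> f)) q'"
    by (simp add: \<Phi>_Comp[OF Z B A w] canonical_via_def)
  moreover have "\<Phi> B Z w \<in> hom D B (G Z)"
    using \<Phi>_hom[OF B Z] w by (rule funcset_mem)
  ultimately show "\<exists>w \<in> hom D B (G Z). \<exists>Q \<in> Ob D. \<exists>q \<in> hom D Q A.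
      canonical_via D A B (\<lambda>f. \<chi> (w \<cdot>\<^bsub>D\<^esub> f)) q"
    using Q' q' by blast
qed

lemma canonical_ramsey_property_transfer:
  assumes ramsey: "canonical_ramsey_property C"
  shows "canonical_ramsey_property D"
  unfolding canonical_ramsey_property_def
proof (intro ballI impI)
  fix A B
  assume A: "A \<in> Ob D" and B: "B \<in> Ob D" and "hom D A B \<noteq> {}"
  then have "hom C (F A) (F B) \<noteq> {}"
    using Fm_hom by blast
  then obtain Z where Z: "Z \<in> Ob C" and arrow: "can_arrow C Z (F B) (F A)"
    using ramsey F_Ob[OF A] F_Ob[OF B] unfolding canonical_ramsey_property_def by blast
  show "\<exists>Z \<in> Ob D. can_arrow D Z B A"
    using G_Ob[OF Z] can_arrow_transfer[OF A B Z arrow] by blast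
qed

end

lemma canonical_pre_adjunction_iff_maps:
  "canonical_pre_adjunction C D F G \<longleftrightarrow> (\<exists>\<Phi> Fm. canonical_pre_adjunction_maps C D F G \<Phi> Fm)"
  unfolding canonical_pre_adjunction_def canonical_pre_adjunction_maps_def canonical_via_def
  by (simp add: Ball_def Pi_iff flip: ex_simps)

theorem theorem5p2:
  fixes C :: "('oc, 'mc) category" and D :: "('od, 'md) category"
  assumes "category C" and "category D"
    and "canonical_ramsey_property C"
    and "\<exists>F G. canonical_pre_adjunction C D F G"
  shows "canonical_ramsey_property D"
proof -
  obtain F G \<Phi> Fm where "canonical_pre_adjunction_maps C D F G \<Phi> Fm"
    using assms(4) unfolding canonical_pre_adjunction_iff_maps by blast
  then show ?thesis
    using assms(3) by (rule canonical_pre_adjunction_maps.canonical_ramsey_property_transfer)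
qed

end
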